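(* For every integer $N\ge 0$ and all values of the tension parameters $\alpha,\beta$, each of the schemes $S_{a_{2N+2}}$, $S_{a_{2N+3}}$ and $S_{a^{I}_{2N+4}}$ generates polynomials up to degree $2N+1$.
   Context: A binary subdivision scheme with finitely supported real mask maps a sequence $f^k=(f^k_i)_{i\in\mathbb Z}$ to a refined sequence $f^{k+1}=(f^{k+1}_i)_{i\in\mathbb Z}$, with the same rules at each level $k\ge 0$. Values $f^k_i$ are attached to the parameters $i/2^k$; a continuous function $F$ is the limit of the scheme for the initial data $f^0$ if for every compact $K\subset\mathbb R$ one has $\sup_{i:\,i/2^k\in K}|F(i/2^k)-f^k_i|\to 0$ as $k\to\infty$. Polynomial generation: the scheme generates polynomials up to degree $d$ if, whenever the initial data are sampled from a polynomial $g$ of degree at most $d$ ($f^0_i=g(i)$), the limit exists and is a polynomial of degree at most $d$ (an operator $\mathbf O$ generates polynomials of degree $d$ if it maps $\Pi_d$, the space of polynomials of degree at most $d$, into $\Pi_d$). Family $S_{a_{2N+2}}$ (one tension parameter $\alpha\in\mathbb R$). Given a sequence $(f_i)_{i\in\mathbb Z}$, define for all $i\in\mathbb Z$ the initial values $$p_{2i,1}=f_i+\alpha(f_{i-1}-2f_i+f_{i+1}),\qquad p_{2i+1,1}=\tfrac12 f_i+\tfrac12 f_{i+1},$$ $$C_{2i,1}=f_{i-1}-f_i+f_{i+1},\qquad C_{2i+1,1}=\tfrac12(f_i+f_{i+1}),$$ and, recursively for $n\ge 1$, $$C_{2i,n+1}=(C_{2i,n}-C_{2(i+1),n})+(C_{2i,n}-C_{2(i-1),n}),$$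 $$C_{2i+1,n+1}=\tfrac1n\left(\tfrac n4-\tfrac18\right)\left[(C_{2i+1,n}-C_{2(i+1)+1,n})+(C_{2i+1,n}-C_{2(i-1)+1,n})\right],$$ $$p_{2i,n+1}=p_{2i,n}+\alpha\, C_{2i,n+1},\qquad p_{2i+1,n+1}=p_{2i+1,n}+C_{2i+1,n+1}.$$ For $N\ge 0$ the mask coefficients $a_{j,N+1}$, $-2(N+1)\le j\le 2(N+1)$ (all other coefficients being $0$), are defined by writing $$p_{2i,N+1}=\sum_{j=-N-1}^{N+1}a_{2j,N+1}f_{i+j},\qquad p_{2i+1,N+1}=\sum_{j=-N-1}^{N}a_{2j+1,N+1}f_{i+j+1}.$$ The scheme $S_{a_{2N+2}}$ is $f^{k+1}_{2i}=\sum_{j=-N-1}^{N+1}a_{2j,N+1}f^k_{i+j}$, $f^{k+1}_{2i+1}=\sum_{j=-N-1}^{N}a_{2j+1,N+1}f^k_{i+j+1}$. Family $S_{a_{2N+3}}$ (two tension parameters $-1<\alpha<1$, $-1<\beta<1$). It is $f^{k+1}_{2i}=\sum_{j=-N-1}^{N+1}b_{2j}f^k_{i+j}$, $f^{k+1}_{2i+1}=\sum_{j=-N-2}^{N+1}b_{2j+1}f^k_{i+j+1}$, where $b_{2j}=a_{2j,N+1}$ for $-N-1\le j\le N+1$, $$b_{2j+1}=a_{2j+1,N+1}+(-1)^{j+N+1}\,\frac{2j+1}{N-j+1}\binom{2N+2}{N+j+2}\beta(1-\alpha)\quad\text{for }-N-1\le j\le N,$$ and $b_{2j+1}=\beta(1-\alpha)$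 for $j=-(N+2)$ and $j=N+1$. Family $S_{a^{I}_{2N+4}}$ (one tension parameter $-1<\beta<1$). It is the scheme $S_{a_{2N+3}}$ with $\alpha=0$ (so $f^{k+1}_{2i}=f^k_i$). *)

theory Defs
  imports "HOL-Analysis.Analysis" "HOL-Computational_Algebra.Polynomial"
begin

section \<open>Binary subdivision schemes: limits and polynomial generation\<close>

text \<open>A scheme is given by its refinement operator on sequences indexed by the integers; level
  \<open>k\<close> of the scheme is the \<open>k\<close>-th iterate. The supremum is taken in \<^typ>\<open>ennreal\<close>, so that
  it is 0 (and not unspecified) when no parameter \<open>i / 2 ^ k\<close> lies in \<open>K\<close>.\<close>

definition scheme_limit ::
  "((int \<Rightarrow> real) \<Rightarrow> int \<Rightarrow> real) \<Rightarrow> (int \<Rightarrow> real) \<Rightarrow> (real \<Rightarrow> real) \<Rightarrow> bool" where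
  "scheme_limit S f0 F \<longleftrightarrow> continuous_on UNIV F \<and>
     (\<forall>K::real set. compact K \<longrightarrow>
       (\<lambda>k::nat. SUP i\<in>{i::int. of_int i / 2 ^ k \<in> K}.
          ennreal \<bar>F (of_int i / 2 ^ k) - (S ^^ k) f0 i\<bar>) \<longlonglongrightarrow> 0)"

definition polys_upto :: "nat \<Rightarrow> (real \<Rightarrow> real) set" where
  "polys_upto d = {poly q | q. degree q \<le> d}"

definition generates_polys_upto :: "((int \<Rightarrow> real) \<Rightarrow> int \<Rightarrow> real) \<Rightarrow> nat \<Rightarrow> bool" where
  "generates_polys_upto S d \<longleftrightarrow>
     (\<forall>g\<in>polys_upto d. \<exists>F\<in>polys_upto d. scheme_limit S (\<lambda>i. g (of_int i)) F)"

text \<open>Limits are unique, so the existential quantifier above speaks about \<^emph>\<open>the\<close> limit.\<close>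

lemma scheme_limit_dyadic:
  assumes "scheme_limit S f0 F"
  shows "(\<lambda>k. (S ^^ k) f0 (i * 2 ^ (k - m))) \<longlonglongrightarrow> F (of_int i / 2 ^ m)"
proof -
  let ?x = "of_int i / 2 ^ m :: real"
  let ?g = "\<lambda>k::nat. SUP j\<in>{j::int. of_int j / 2 ^ k \<in> {?x}}.
          ennreal \<bar>F (of_int j / 2 ^ k) - (S ^^ k) f0 j\<bar>"
  have lim: "?g \<longlonglongrightarrow> 0"
    using assms unfolding scheme_limit_def by (meson compact_sing)
  have bound: "ennreal \<bar>F ?x - (S ^^ k) f0 (i * 2 ^ (k - m))\<bar> \<le> ?g k" if "k \<ge> m" for k
  proof -
    have eq: "of_int (i * 2 ^ (k - m)) / 2 ^ k = ?x"
      using that by (auto simp: le_iff_add power_add)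
    have "ennreal \<bar>F (of_int (i * 2 ^ (k - m)) / 2 ^ k) - (S ^^ k) f0 (i * 2 ^ (k - m))\<bar> \<le> ?g k"
      by (rule SUP_upper) (use eq in simp)
    then show ?thesis unfolding eq .
  qed
  have "(\<lambda>k. ennreal \<bar>F ?x - (S ^^ k) f0 (i * 2 ^ (k - m))\<bar>) \<longlonglongrightarrow> 0"
  proof (rule tendsto_sandwich[OF _ _ tendsto_const lim])
    show "\<forall>\<^sub>F k in sequentially. ennreal \<bar>F ?x - (S ^^ k) f0 (i * 2 ^ (k - m))\<bar> \<le> ?g k"
      by (rule eventually_sequentiallyI[of m]) (rule bound)
  qed simp
  then have "(\<lambda>k. \<bar>F ?x - (S ^^ k) f0 (i * 2 ^ (k - m))\<bar>) \<longlonglongrightarrow> 0"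
    by (simp add: ennreal_tendsto_0_iff)
  then have "(\<lambda>k. F ?x - (S ^^ k) f0 (i * 2 ^ (k - m))) \<longlonglongrightarrow> 0"
    by (simp add: tendsto_rabs_zero_iff)
  from tendsto_diff[OF tendsto_const[of "F ?x"] this] show ?thesis by simp
qed

lemma scheme_limit_unique:
  assumes F: "scheme_limit S f0 F" and G: "scheme_limit S f0 G"
  shows "F = G"
proof
  fix x :: real
  have cF: "isCont F y" and cG: "isCont G y" for y
    using F G unfolding scheme_limit_def by (auto simp: continuous_on_eq_continuous_at)
  define d :: "nat \<Rightarrow> real" where "d m = of_int \<lfloor>x * 2 ^ m\<rfloor> / 2 ^ m" for m
  have eq: "F (d m) = G (d m)" for m
    unfolding d_def
    using LIMSEQ_unique[OF scheme_limit_dyadic[OF F] scheme_limit_dyadic[OF G]] .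
  have d: "d \<longlonglongrightarrow> x"
  proof (rule tendsto_sandwich)
    show "\<forall>\<^sub>F m in sequentially. x - (1/2) ^ m \<le> d m"
    proof (rule always_eventually, rule allI)
      fix m :: nat
      have "x * 2 ^ m - 1 \<le> of_int \<lfloor>x * 2 ^ m\<rfloor>" by linarith
      then have "(x * 2 ^ m - 1) / 2 ^ m \<le> d m"
        unfolding d_def by (rule divide_right_mono) simp
      then show "x - (1/2) ^ m \<le> d m" by (simp add: diff_divide_distrib power_one_over)
    qed
    show "\<forall>\<^sub>F m in sequentially. d m \<le> x"
    proof (rule always_eventually, rule allI)
      fix m :: nat
      have "d m \<le> x * 2 ^ m / 2 ^ m"
        unfolding d_def by (rule divide_right_mono) auto
      then show "d m \<le> x" by simp
    qed
    have "(\<lambda>m. (1/2 :: real) ^ m) \<longlonglongrightarrow> 0" by (rule LIMSEQ_power_zero) simp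
    from tendsto_diff[OF tendsto_const[of x] this]
    show "(\<lambda>m. x - (1/2) ^ m) \<longlonglongrightarrow> x" by simp
    show "(\<lambda>m::nat. x) \<longlonglongrightarrow> x" by simp
  qed
  have "(\<lambda>m. F (d m)) \<longlonglongrightarrow> F x" "(\<lambda>m. G (d m)) \<longlonglongrightarrow> G x"
    using isCont_tendsto_compose[OF cF d] isCont_tendsto_compose[OF cG d] .
  then show "F x = G x" unfolding eq by (rule LIMSEQ_unique)
qed

section \<open>The recursive construction of the masks\<close>

text \<open>The level index is shifted by one: \<open>aux_C f n k\<close> is \<open>C\<^bsub>k,n+1\<^esub>\<close> and \<open>aux_p \<alpha> f n k\<close> is
  \<open>p\<^bsub>k,n+1\<^esub>\<close>. Accordingly the factor \<open>(1/n) (n/4 - 1/8)\<close> of the passage from \<open>n\<close> to \<open>n+1\<close>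
  appears with \<open>Suc n\<close> in place of \<open>n\<close>. For both parities \<open>k = 2i\<close> and \<open>k = 2i+1\<close> we have
  \<open>i = k div 2\<close>.\<close>

primrec aux_C :: "(int \<Rightarrow> real) \<Rightarrow> nat \<Rightarrow> int \<Rightarrow> real" where
  "aux_C f 0 k = (let i = k div 2 in
     if even k then f (i - 1) - f i + f (i + 1) else 1 / 2 * (f i + f (i + 1)))"
| "aux_C f (Suc n) k =
     (if even k
      then (aux_C f n k - aux_C f n (k + 2)) + (aux_C f n k - aux_C f n (k - 2))
      else 1 / real (Suc n) * (real (Suc n) / 4 - 1 / 8) *
             ((aux_C f n k - aux_C f n (k + 2)) + (aux_C f n k - aux_C f n (k - 2))))"

primrec aux_p :: "real \<Rightarrow> (int \<Rightarrow> real) \<Rightarrow> nat \<Rightarrow> int \<Rightarrow> real" where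
  "aux_p \<alpha> f 0 k = (let i = k div 2 in
     if even k then f i + \<alpha> * (f (i - 1) - 2 * f i + f (i + 1))
     else 1 / 2 * f i + 1 / 2 * f (i + 1))"
| "aux_p \<alpha> f (Suc n) k =
     (if even k then aux_p \<alpha> f n k + \<alpha> * aux_C f (Suc n) k
      else aux_p \<alpha> f n k + aux_C f (Suc n) k)"

text \<open>The mask \<open>a\<^bsub>\<cdot>,N+1\<^esub>\<close> consists of the coefficients in the expansion of \<open>p\<^bsub>\<cdot>,N+1\<^esub>\<close> in
  terms of the data; the expansion exists and is unique by the lemma \<open>ex1_is_mask\<close> below.\<close>

definition is_mask :: "real \<Rightarrow> nat \<Rightarrow> (int \<Rightarrow> real) \<Rightarrow> bool" where
  "is_mask \<alpha> N a \<longleftrightarrow>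
     (\<forall>f i. aux_p \<alpha> f N (2 * i) = (\<Sum>j = - int N - 1..int N + 1. a (2 * j) * f (i + j))) \<and>
     (\<forall>f i. aux_p \<alpha> f N (2 * i + 1) = (\<Sum>j = - int N - 1..int N. a (2 * j + 1) * f (i + j + 1))) \<and>
     (\<forall>k. k < - 2 * (int N + 1) \<or> 2 * (int N + 1) < k \<longrightarrow> a k = 0)"

definition mask_a :: "real \<Rightarrow> nat \<Rightarrow> int \<Rightarrow> real" where
  "mask_a \<alpha> N = (THE a. is_mask \<alpha> N a)"

definition expands :: "int \<Rightarrow> int \<Rightarrow> ((int \<Rightarrow> real) \<Rightarrow> int \<Rightarrow> real) \<Rightarrow> bool" where
  "expands l u h \<longleftrightarrow> (\<exists>c. \<forall>f i. h f i = (\<Sum>j = l..u. c j * f (i + j)))"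

lemma expands_mono:
  assumes "expands l u h" "l' \<le> l" "u \<le> u'"
  shows "expands l' u' h"
proof -
  obtain c where c: "\<And>f i. h f i = (\<Sum>j = l..u. c j * f (i + j))"
    using assms(1) unfolding expands_def by blast
  have "h f i = (\<Sum>j = l'..u'. (if j \<in> {l..u} then c j else 0) * f (i + j))" for f i
    unfolding c using assms(2,3) by (intro sum.mono_neutral_cong_left) auto
  then show ?thesis unfolding expands_def
    by (intro exI[of _ "\<lambda>j. if j \<in> {l..u} then c j else 0"]) blast
qed

lemma expands_shift:
  assumes "l \<le> s" "s \<le> u"
  shows "expands l u (\<lambda>f i. f (i + s))"
proof -
  have "f (i + s) = (\<Sum>j = l..u. (if j = s then 1 else 0) * f (i + j))" for f :: "int \<Rightarrow> real" and i
    using assms by (simp add: if_distrib[of "\<lambda>x. x * _"] sum.delta cong: if_cong)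
  then show ?thesis unfolding expands_def
    by (intro exI[of _ "\<lambda>j. if j = s then 1 else 0"]) blast
qed

lemma expands_shift_arg:
  assumes "expands l u h"
  shows "expands (l + s) (u + s) (\<lambda>f i. h f (i + s))"
proof -
  obtain c where c: "\<And>f i. h f i = (\<Sum>j = l..u. c j * f (i + j))"
    using assms(1) unfolding expands_def by blast
  have "h f (i + s) = (\<Sum>j = l + s..u + s. c (j - s) * f (i + j))" for f i
    unfolding c
    by (rule sum.reindex_bij_witness[of _ "\<lambda>j. j - s" "\<lambda>j. j + s"]) (auto simp: algebra_simps)
  then show ?thesis unfolding expands_def
    by (intro exI[of _ "\<lambda>j. c (j - s)"]) blast
qed

lemma expands_lin:
  assumes "expands l u h" "expands l u g"
  shows "expands l u (\<lambda>f i. x * h f i + y * g f i)"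
proof -
  obtain c d where c: "\<And>f i. h f i = (\<Sum>j = l..u. c j * f (i + j))"
    and d: "\<And>f i. g f i = (\<Sum>j = l..u. d j * f (i + j))"
    using assms unfolding expands_def by blast
  have "x * h f i + y * g f i = (\<Sum>j = l..u. (x * c j + y * d j) * f (i + j))" for f i
    unfolding c d by (simp add: sum_distrib_left sum.distrib algebra_simps)
  then show ?thesis unfolding expands_def
    by (intro exI[of _ "\<lambda>j. x * c j + y * d j"]) blast
qed

lemma expands_second_difference:
  assumes "expands l u h"
  shows "expands (l - 1) (u + 1) (\<lambda>f i. x * ((h f i - h f (i + 1)) + (h f i - h f (i - 1))))"
proof -
  have 1: "expands (l - 1) (u + 1) h"
    using assms by (rule expands_mono) auto
  have 2: "expands (l - 1) (u + 1) (\<lambda>f i. h f (i + 1))"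
    using expands_shift_arg[OF assms, of 1] by (rule expands_mono) auto
  have 3: "expands (l - 1) (u + 1) (\<lambda>f i. h f (i - 1))"
    using expands_mono[OF expands_shift_arg[OF assms, of "-1"], of "l - 1" "u + 1"] by simp
  show ?thesis
    using expands_lin[OF expands_lin[OF 1 2, of "2 * x" "- x"] 3, of 1 "- x"]
    by (simp add: algebra_simps)
qed

lemma expands_aux_C_even: "expands (- int n - 1) (int n + 1) (\<lambda>f i. aux_C f n (2 * i))"
proof (induction n)
  case 0
  have s: "expands (- 1) 1 (\<lambda>f i. f (i + s))" if "s \<in> {-1, 0, 1}" for s
    using that by (intro expands_shift) auto
  show ?case
    using expands_lin[OF expands_lin[OF s[of "-1"] s[of 0], of 1 "-1"] s[of 1], of 1 1] by simp
next
  case (Suc n)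
  show ?case
    using expands_second_difference[OF Suc, of 1] by (simp add: algebra_simps)
qed

lemma expands_aux_C_odd: "expands (- int n) (int n + 1) (\<lambda>f i. aux_C f n (2 * i + 1))"
proof (induction n)
  case 0
  have s: "expands 0 1 (\<lambda>f i. f (i + s))" if "s \<in> {0, 1}" for s
    using that by (intro expands_shift) auto
  show ?case
    using expands_lin[OF s[of 0] s[of 1], of "1/2" "1/2"] by (simp add: algebra_simps)
next
  case (Suc n)
  let ?x = "1 / real (Suc n) * (real (Suc n) / 4 - 1 / 8)"
  have i: "2 * (i + 1) + 1 = 2 * i + 1 + 2" "2 * (i - 1) + 1 = 2 * i + 1 - 2" for i :: int
    by simp_all
  have "aux_C f (Suc n) (2 * i + 1) =
      ?x * ((aux_C f n (2 * i + 1) - aux_C f n (2 * (i + 1) + 1)) +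
            (aux_C f n (2 * i + 1) - aux_C f n (2 * (i - 1) + 1)))" for f i
    unfolding i aux_C.simps(2) by simp
  moreover have "- int n - 1 = - int (Suc n)" "int n + 1 + 1 = int (Suc n) + 1"
    by simp_all
  ultimately show ?case
    using expands_second_difference[OF Suc, of ?x] by (simp only:)
qed

lemma expands_aux_p_even: "expands (- int n - 1) (int n + 1) (\<lambda>f i. aux_p \<alpha> f n (2 * i))"
proof (induction n)
  case 0
  have s: "expands (- 1) 1 (\<lambda>f i. f (i + s))" if "s \<in> {-1, 0, 1}" for s
    using that by (intro expands_shift) auto
  show ?case
    using expands_lin[OF expands_lin[OF s[of "-1"] s[of 0], of \<alpha> "1 - 2 * \<alpha>"] s[of 1], of 1 \<alpha>]
    by (simp add: algebra_simps)
next
  case (Suc n)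
  have "expands (- int (Suc n) - 1) (int (Suc n) + 1) (\<lambda>f i. aux_p \<alpha> f n (2 * i))"
    using Suc by (rule expands_mono) auto
  from expands_lin[OF this expands_aux_C_even, of 1 \<alpha>] show ?case
    by (simp del: aux_C.simps)
qed

lemma expands_aux_p_odd: "expands (- int n) (int n + 1) (\<lambda>f i. aux_p \<alpha> f n (2 * i + 1))"
proof (induction n)
  case 0
  have s: "expands 0 1 (\<lambda>f i. f (i + s))" if "s \<in> {0, 1}" for s
    using that by (intro expands_shift) auto
  show ?case
    using expands_lin[OF s[of 0] s[of 1], of "1/2" "1/2"] by (simp add: algebra_simps)
next
  case (Suc n)
  have "expands (- int (Suc n)) (int (Suc n) + 1) (\<lambda>f i. aux_p \<alpha> f n (2 * i + 1))"
    using Suc by (rule expands_mono) auto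
  from expands_lin[OF this expands_aux_C_odd, of 1 1] show ?case
    by (simp del: aux_C.simps)
qed

lemma ex_is_mask: "\<exists>a. is_mask \<alpha> N a"
proof -
  obtain c where c: "\<And>f i. aux_p \<alpha> f N (2 * i) = (\<Sum>j = - int N - 1..int N + 1. c j * f (i + j))"
    using expands_aux_p_even[of N \<alpha>] unfolding expands_def by blast
  obtain d where d: "\<And>f i. aux_p \<alpha> f N (2 * i + 1) = (\<Sum>j = - int N..int N + 1. d j * f (i + j))"
    using expands_aux_p_odd[of N \<alpha>] unfolding expands_def by blast
  have d': "aux_p \<alpha> f N (2 * i + 1) = (\<Sum>j = - int N - 1..int N. d (j + 1) * f (i + j + 1))" for f i
    unfolding d
    by (rule sum.reindex_bij_witness[of _ "\<lambda>j. j + 1" "\<lambda>j. j - 1"]) (auto simp: algebra_simps)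
  define a where "a k = (if k < - 2 * (int N + 1) \<or> 2 * (int N + 1) < k then 0
     else if even k then c (k div 2) else d (k div 2 + 1))" for k
  have "is_mask \<alpha> N a"
    unfolding is_mask_def
  proof (intro conjI allI impI)
    show "aux_p \<alpha> f N (2 * i) = (\<Sum>j = - int N - 1..int N + 1. a (2 * j) * f (i + j))" for f i
      unfolding c by (intro sum.cong) (auto simp: a_def)
    show "aux_p \<alpha> f N (2 * i + 1) = (\<Sum>j = - int N - 1..int N. a (2 * j + 1) * f (i + j + 1))" for f i
      unfolding d' by (intro sum.cong) (auto simp: a_def)
  qed (simp add: a_def)
  then show ?thesis by blast
qed

lemma is_mask_unique:
  assumes a: "is_mask \<alpha> N a" and b: "is_mask \<alpha> N b"
  shows "a = b"
proof
  fix k :: int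
  define j where "j = k div 2"
  show "a k = b k"
  proof (cases "k < - 2 * (int N + 1) \<or> 2 * (int N + 1) < k")
    case True
    then show ?thesis using a b unfolding is_mask_def by metis
  next
    case False
    have delta: "(\<Sum>i\<in>A. e i * (if i = j then 1 else 0)) = e j" if "finite A" "j \<in> A"
      for A and e :: "int \<Rightarrow> real"
      using that by (simp add: if_distrib cong: if_cong)
    show ?thesis
    proof (cases "even k")
      case True
      then have k: "k = 2 * j" by (simp add: j_def)
      have "e (2 * j) = aux_p \<alpha> (\<lambda>i. if i = j then 1 else 0) N (2 * 0)" if "is_mask \<alpha> N e" for e
      proof -
        have "aux_p \<alpha> (\<lambda>i. if i = j then 1 else 0) N (2 * 0) =
            (\<Sum>i = - int N - 1..int N + 1. e (2 * i) * (if 0 + i = j then 1 else 0))"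
          using that unfolding is_mask_def by blast
        also have "\<dots> = e (2 * j)"
          unfolding add_0 by (rule delta) (use False k in auto)
        finally show ?thesis ..
      qed
      from this[OF a] this[OF b] show ?thesis by (simp add: k)
    next
      case odd: False
      then have k: "k = 2 * j + 1" by (simp add: j_def)
      have "e (2 * j + 1) = aux_p \<alpha> (\<lambda>i. if i = j + 1 then 1 else 0) N (2 * 0 + 1)"
        if "is_mask \<alpha> N e" for e
      proof -
        have "aux_p \<alpha> (\<lambda>i. if i = j + 1 then 1 else 0) N (2 * 0 + 1) =
            (\<Sum>i = - int N - 1..int N. e (2 * i + 1) * (if 0 + i + 1 = j + 1 then 1 else 0))"
          using that unfolding is_mask_def by blast
        also have "\<dots> = (\<Sum>i = - int N - 1..int N. e (2 * i + 1) * (if i = j then 1 else 0))"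
          by (intro sum.cong) auto
        also have "\<dots> = e (2 * j + 1)"
          by (rule delta) (use False k in auto)
        finally show ?thesis ..
      qed
      from this[OF a] this[OF b] show ?thesis by (simp add: k)
    qed
  qed
qed

lemma ex1_is_mask: "\<exists>!a. is_mask \<alpha> N a"
  using ex_is_mask is_mask_unique by blast

lemma is_mask_mask_a: "is_mask \<alpha> N (mask_a \<alpha> N)"
  unfolding mask_a_def by (rule theI'[OF ex1_is_mask])

section \<open>The three families of schemes\<close>

definition scheme_2N2 :: "nat \<Rightarrow> real \<Rightarrow> (int \<Rightarrow> real) \<Rightarrow> int \<Rightarrow> real" where
  "scheme_2N2 N \<alpha> f k = (let i = k div 2 in
     if even k then (\<Sum>j = - int N - 1..int N + 1. mask_a \<alpha> N (2 * j) * f (i + j))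
     else (\<Sum>j = - int N - 1..int N. mask_a \<alpha> N (2 * j + 1) * f (i + j + 1)))"

text \<open>The arguments of \<^const>\<open>nat\<close> below are nonnegative on the range in which they are used.\<close>

definition mask_b :: "nat \<Rightarrow> real \<Rightarrow> real \<Rightarrow> int \<Rightarrow> real" where
  "mask_b N \<alpha> \<beta> k = (let j = k div 2 in
     if even k then (if j \<in> {- int N - 1..int N + 1} then mask_a \<alpha> N (2 * j) else 0)
     else if j \<in> {- int N - 1..int N} then
       mask_a \<alpha> N (2 * j + 1) +
       (- 1) ^ nat (j + int N + 1) * (of_int (2 * j + 1) / of_int (int N - j + 1)) *
         real ((2 * N + 2) choose nat (int N + j + 2)) * \<beta> * (1 - \<alpha>)
     else if j = - (int N + 2) \<or> j = int N + 1 then \<beta> * (1 - \<alpha>)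
     else 0)"

definition scheme_2N3 :: "nat \<Rightarrow> real \<Rightarrow> real \<Rightarrow> (int \<Rightarrow> real) \<Rightarrow> int \<Rightarrow> real" where
  "scheme_2N3 N \<alpha> \<beta> f k = (let i = k div 2 in
     if even k then (\<Sum>j = - int N - 1..int N + 1. mask_b N \<alpha> \<beta> (2 * j) * f (i + j))
     else (\<Sum>j = - int N - 2..int N + 1. mask_b N \<alpha> \<beta> (2 * j + 1) * f (i + j + 1)))"

definition scheme_I_2N4 :: "nat \<Rightarrow> real \<Rightarrow> (int \<Rightarrow> real) \<Rightarrow> int \<Rightarrow> real" where
  "scheme_I_2N4 N \<beta> = scheme_2N3 N 0 \<beta>"

end

theory Submission imports Defs begin

text \<open>All the schemes reproduce polynomials of degree at most \<open>2N+1\<close> exactly: samples of \<open>g\<close> at the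
  integers are mapped to samples of \<open>g\<close> at the half integers, so that the limit is \<open>g\<close> itself. With
  \<open>E = - \<delta>\<^sup>2\<close> the negated second difference, the recursion telescopes at even indices to
  \<open>f - \<alpha> E\<^bsup>N+1\<^esup> f\<close>. At odd indices it gives the truncation of \<open>\<mu> (1 - E/4)\<^bsup>-1/2\<^esup> f\<close> (\<open>\<mu>\<close> the average
  of neighbours), Bessel's formula for interpolation at midpoints; it is exact because it is exact on
  the basis \<open>q\<^sub>k\<close>, \<open>y q\<^sub>k\<close>, where \<open>q\<^sub>k(y) = \<Prod>m<k. (y\<^sup>2 - (m+1/2)\<^sup>2)\<close> satisfies
  \<open>E q\<^bsub>k+1\<^esub> = - (2k+1)(2k+2) q\<^sub>k\<close> and vanishes at \<open>\<plusminus>1/2\<close> for \<open>k > 0\<close>. The additional term of the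
  second family is, up to a constant, the \<open>(2N+3)\<close>-rd difference of \<open>g\<close> times a linear polynomial.\<close>

section \<open>Differences of polynomials\<close>

text \<open>The shift preserves degree and leading coefficient, so the top terms cancel. The zero
  alternative is what remains when \<open>d = 0\<close>.\<close>

lemma degree_forward_diff:
  fixes p :: "real poly"
  assumes "p = 0 \<or> degree p < Suc d"
  shows "pcompose p [:1, 1:] - p = 0 \<or> degree (pcompose p [:1, 1:] - p) < d"
proof (cases "degree p = 0")
  case True
  then show ?thesis by (auto elim!: degree_eq_zeroE)
next
  case False
  have "degree (pcompose p [:1, 1:]) = degree p" by (simp add: degree_pcompose)
  moreover have "lead_coeff (pcompose p [:1, 1:]) = lead_coeff p" by (simp add: lead_coeff_comp)
  ultimately have "pcompose p [:1, 1:] - p = 0 \<or> degree (pcompose p [:1, 1:] - p) < degree p"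
    by (intro eq_zero_or_degree_less) (auto intro: degree_diff_le)
  then show ?thesis using assms False by auto
qed

text \<open>Up to sign this is the \<open>M\<close>-th forward difference of \<open>p\<close> at
  \<open>x\<close>; Pascal's rule lowers the order by passing to the difference
  \<open>?r\<close>.\<close>

lemma alternating_binomial_poly_sum:
  fixes p :: "real poly"
  assumes "p = 0 \<or> degree p < M"
  shows "(\<Sum>m\<le>M. (- 1) ^ m * real (M choose m) * poly p (x + real m)) = 0"
  using assms
proof (induction M arbitrary: p)
  case (Suc M)
  let ?r = "pcompose p [:1, 1:] - p"
  have split: "(\<Sum>m\<le>Suc M. g m * real (Suc M choose m))
     = (\<Sum>m\<le>M. (g m + g (Suc m)) * real (M choose m))" for g :: "nat \<Rightarrow> real"
  proof -
    have "(\<Sum>m\<le>Suc M. g m * real (Suc M choose m))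
        = g 0 + (\<Sum>m\<le>M. g (Suc m) * real (Suc M choose Suc m))"
      by (subst sum.atMost_Suc_shift) simp
    also have "\<dots> = (\<Sum>m\<le>M. g (Suc m) * real (M choose m))
        + (g 0 + (\<Sum>m\<le>M. g (Suc m) * real (M choose Suc m)))"
      by (simp add: algebra_simps sum.distrib)
    also have "g 0 + (\<Sum>m\<le>M. g (Suc m) * real (M choose Suc m))
        = (\<Sum>m\<le>Suc M. g m * real (M choose m))"
      by (subst sum.atMost_Suc_shift) simp
    also have "\<dots> = (\<Sum>m\<le>M. g m * real (M choose m))" by simp
    finally show ?thesis by (simp add: algebra_simps sum.distrib)
  qed
  have "(\<Sum>m\<le>Suc M. (- 1) ^ m * real (Suc M choose m) * poly p (x + real m))
      = (\<Sum>m\<le>Suc M. ((- 1) ^ m * poly p (x + real m)) * real (Suc M choose m))"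
    by (simp add: mult_ac)
  also have "\<dots> = - (\<Sum>m\<le>M. (- 1) ^ m * real (M choose m) * poly ?r (x + real m))"
    unfolding split sum_negf[symmetric]
    by (intro sum.cong) (auto simp: poly_pcompose algebra_simps)
  also have "\<dots> = 0" using Suc.IH[OF degree_forward_diff[OF Suc.prems]] by simp
  finally show ?case .
qed simp

text \<open>Polymorphic so that one operator acts both on integer sequences and on functions of a
  real variable.\<close>

definition neg_diff2 :: "('a::ring_1 \<Rightarrow> real) \<Rightarrow> 'a \<Rightarrow> real" where
  "neg_diff2 f x = 2 * f x - f (x + 1) - f (x - 1)"

lemma neg_diff2_funpow_linear:
  "(neg_diff2 ^^ n) (\<lambda>x. a * f x + g x) = (\<lambda>x. a * (neg_diff2 ^^ n) f x + (neg_diff2 ^^ n) g x)"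
  by (induction n) (auto simp: neg_diff2_def algebra_simps)

lemma neg_diff2_funpow_zero: "(neg_diff2 ^^ n) (\<lambda>x. 0) = (\<lambda>x. 0)"
  by (induction n) (auto simp: neg_diff2_def)

lemma neg_diff2_funpow_scale: "(neg_diff2 ^^ n) (\<lambda>x. a * f x) = (\<lambda>x. a * (neg_diff2 ^^ n) f x)"
  using neg_diff2_funpow_linear[of n a f "\<lambda>x. 0"] by (simp add: neg_diff2_funpow_zero)

lemma neg_diff2_funpow_of_int:
  fixes h :: "real \<Rightarrow> real"
  shows "(neg_diff2 ^^ n) (\<lambda>j::int. h (of_int j + t)) = (\<lambda>j. (neg_diff2 ^^ n) h (of_int j + t))"
  by (induction n) (auto simp: neg_diff2_def algebra_simps)

lemma neg_diff2_funpow_odd: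
  fixes h :: "real \<Rightarrow> real"
  assumes "\<And>y. h (- y) = - h y"
  shows "(neg_diff2 ^^ n) h (- y) = - (neg_diff2 ^^ n) h y"
proof (induction n arbitrary: y)
  case (Suc n)
  have "(neg_diff2 ^^ n) h (- y + 1) = - (neg_diff2 ^^ n) h (y - 1)"
    "(neg_diff2 ^^ n) h (- y - 1) = - (neg_diff2 ^^ n) h (y + 1)"
    using Suc[of "y - 1"] Suc[of "y + 1"] by simp_all
  then show ?case using Suc[of y] by (simp add: neg_diff2_def[of "(neg_diff2 ^^ n) h"])
qed (use assms in simp)

text \<open>One application is two forward differences, a shift back by one and a change of sign, so
  it lowers the degree by two.\<close>

lemma neg_diff2_funpow_poly:
  fixes p :: "real poly"
  assumes "p = 0 \<or> degree p < 2 * n"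
  shows "(neg_diff2 ^^ n) (poly p) = (\<lambda>x. 0)"
  using assms
proof (induction n arbitrary: p)
  case (Suc n)
  define r where "r = pcompose p [:1, 1:] - p"
  define s where "s = pcompose r [:1, 1:] - r"
  define t where "t = - pcompose s [:- 1, 1:]"
  have "r = 0 \<or> degree r < Suc (2 * n)"
    unfolding r_def using Suc.prems by (intro degree_forward_diff) simp
  then have "s = 0 \<or> degree s < 2 * n"
    unfolding s_def by (rule degree_forward_diff)
  then have "t = 0 \<or> degree t < 2 * n"
    unfolding t_def by (auto simp: degree_pcompose)
  then have "(neg_diff2 ^^ n) (poly t) = (\<lambda>x. 0)" by (rule Suc.IH)
  moreover have "neg_diff2 (poly p) = poly t"
    by (rule ext) (simp add: t_def s_def r_def neg_diff2_def poly_pcompose algebra_simps)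
  ultimately show ?case by (simp add: funpow_Suc_right del: funpow.simps)
qed auto

section \<open>Interpolation at midpoints\<close>

text \<open>The Taylor coefficients \<open>(2n choose n) / 16^n\<close> of
  \<open>(1 - x/4)^(-1/2)\<close>.\<close>

definition mid_coeff :: "nat \<Rightarrow> real" where
  "mid_coeff n = (\<Prod>m<n. (2 * real m + 1) / (8 * (real m + 1)))"

definition mid_basis :: "nat \<Rightarrow> real poly" where
  "mid_basis k = (\<Prod>m<k. [:- ((real m + 1 / 2)\<^sup>2), 0, 1:])"

lemma mid_basis_Suc: "mid_basis (Suc k) = [:- ((real k + 1 / 2)\<^sup>2), 0, 1:] * mid_basis k"
  by (simp add: mid_basis_def)

lemma poly_mid_basis_Suc:
  "poly (mid_basis (Suc k)) y = (y\<^sup>2 - (real k + 1 / 2)\<^sup>2) * poly (mid_basis k) y"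
  by (simp only: mid_basis_Suc poly_mult) (simp add: algebra_simps power2_eq_square)

lemma poly_mid_basis_even: "poly (mid_basis k) (- y) = poly (mid_basis k) y"
  by (simp add: mid_basis_def poly_prod)

lemma mid_basis_monic: "degree (mid_basis k) = 2 * k \<and> lead_coeff (mid_basis k) = 1"
proof (induction k)
  case (Suc k)
  then have "mid_basis k \<noteq> 0" by auto
  then have "degree (mid_basis (Suc k)) = 2 + degree (mid_basis k)"
    unfolding mid_basis_Suc by (subst degree_mult_eq) auto
  moreover have "lead_coeff (mid_basis (Suc k)) = 1"
    unfolding mid_basis_Suc lead_coeff_mult by (simp add: conjunct2[OF Suc])
  ultimately show ?case using Suc by simp
qed (simp add: mid_basis_def)

text \<open>The value at \<open>y\<close> is the product of \<open>2k\<close> consecutive factors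
  from \<open>y - (k - 1/2)\<close> to \<open>y + (k - 1/2)\<close>; a unit shift drops the first
  and appends \<open>y + (k + 1/2)\<close>.\<close>

lemma mid_basis_shift:
  "poly (mid_basis k) (y + 1) * (y + 1 - (real k + 1 / 2)) = poly (mid_basis k) y * (y + (real k + 1 / 2))"
proof (induction k)
  case (Suc k)
  define a where "a = real k + 1 / 2"
  have a: "real (Suc k) + 1 / 2 = a + 1" by (simp add: a_def)
  have "poly (mid_basis (Suc k)) (y + 1) * (y + 1 - (a + 1))
      = (poly (mid_basis k) (y + 1) * (y + 1 - a)) * ((y + 1 + a) * (y - a))"
    unfolding poly_mid_basis_Suc a_def[symmetric] by algebra
  also have "\<dots> = poly (mid_basis (Suc k)) y * (y + (a + 1))"
    unfolding a_def Suc unfolding poly_mid_basis_Suc a_def[symmetric] by algebra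
  finally show ?case unfolding a .
qed (simp add: mid_basis_def)

lemma neg_diff2_mid_basis:
  "neg_diff2 (poly (mid_basis (Suc k)))
     = (\<lambda>y. (- ((2 * real k + 1) * (2 * real k + 2))) * poly (mid_basis k) y)"
proof
  fix y
  define a where "a = real k + 1 / 2"
  have up: "poly (mid_basis (Suc k)) (y + 1) = poly (mid_basis k) y * ((y + a) * (y + 1 + a))" for y
  proof -
    have "poly (mid_basis (Suc k)) (y + 1)
        = (poly (mid_basis k) (y + 1) * (y + 1 - a)) * (y + 1 + a)"
      unfolding poly_mid_basis_Suc a_def[symmetric] by algebra
    then show ?thesis unfolding a_def mid_basis_shift by (simp only: mult.assoc add_ac)
  qed
  \<comment> \<open>Evenness turns the step down at \<open>y\<close> into a step up at
    \<open>- y\<close>, so \<open>up\<close> covers both neighbours.\<close>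
  have "poly (mid_basis (Suc k)) (y - 1) = poly (mid_basis (Suc k)) (- y + 1)"
    using poly_mid_basis_even[of "Suc k" "y - 1"] by simp
  also have "\<dots> = poly (mid_basis k) y * ((- y + a) * (- y + 1 + a))"
    unfolding up poly_mid_basis_even ..
  finally have "neg_diff2 (poly (mid_basis (Suc k))) y
      = (- ((2 * a) * (2 * a + 1))) * poly (mid_basis k) y"
    unfolding neg_diff2_def up unfolding poly_mid_basis_Suc a_def[symmetric] by algebra
  then show "neg_diff2 (poly (mid_basis (Suc k))) y
      = (- ((2 * real k + 1) * (2 * real k + 2))) * poly (mid_basis k) y"
    by (simp add: a_def algebra_simps)
qed

text \<open>Each application lowers the index by one. If \<open>n < k\<close>, a polynomial
  vanishing at \<plusminus>1/2 is left; if \<open>n > k\<close>, the constant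
  \<open>mid_basis 0\<close> has been annihilated.\<close>

lemma neg_diff2_funpow_mid_basis:
  assumes "y\<^sup>2 = 1 / 4"
  shows "(neg_diff2 ^^ n) (poly (mid_basis k)) y = (if n = k then (- 1) ^ k * fact (2 * k) else 0)"
proof (induction n arbitrary: k)
  case 0
  have "poly (mid_basis (Suc k)) y = 0" for k
    by (induction k) (use assms in \<open>auto simp: mid_basis_def power2_eq_square\<close>)
  then show ?case by (cases k) (auto simp: mid_basis_def)
next
  case (Suc n)
  show ?case
  proof (cases k)
    case 0
    then show ?thesis using neg_diff2_funpow_poly[of "mid_basis 0" "Suc n"]
      by (simp add: 0 mid_basis_def del: funpow.simps poly_1)
  next
    case (Suc k')
    have "(neg_diff2 ^^ Suc n) (poly (mid_basis k)) y
        = (- ((2 * real k' + 1) * (2 * real k' + 2))) * (neg_diff2 ^^ n) (poly (mid_basis k')) y"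
      unfolding Suc funpow_Suc_right o_apply neg_diff2_mid_basis neg_diff2_funpow_scale ..
    also have "\<dots> = (if Suc n = k then (- 1) ^ k * fact (2 * k) else 0)"
      unfolding Suc.IH Suc by (simp add: algebra_simps)
    finally show ?thesis .
  qed
qed

definition mid_interp :: "nat \<Rightarrow> (real \<Rightarrow> real) \<Rightarrow> real" where
  "mid_interp N h =
     (\<Sum>n\<le>N. mid_coeff n * (((neg_diff2 ^^ n) h (- 1 / 2) + (neg_diff2 ^^ n) h (1 / 2)) / 2))"

lemma mid_interp_linear: "mid_interp N (\<lambda>x. a * f x + g x) = a * mid_interp N f + mid_interp N g"
  unfolding mid_interp_def neg_diff2_funpow_linear
  by (simp add: sum_distrib_left sum.distrib[symmetric] algebra_simps add_divide_distrib)

text \<open>Both sides gain the factor \<open>- (k + 1/2)^2\<close>. The left side is the only term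
  of \<open>mid_interp\<close> that survives on \<open>mid_basis k\<close>.\<close>

lemma mid_coeff_fact: "mid_coeff k * ((- 1) ^ k * fact (2 * k)) = poly (mid_basis k) 0"
proof (induction k)
  case (Suc k)
  have mid: "mid_coeff (Suc k) = mid_coeff k * ((2 * real k + 1) / (8 * (real k + 1)))"
    by (simp add: mid_coeff_def)
  have fact: "fact (2 * Suc k) = (2 * real k + 1) * (2 * real k + 2) * fact (2 * k)"
    by (simp add: algebra_simps)
  have "mid_coeff (Suc k) * ((- 1) ^ Suc k * fact (2 * Suc k))
      = (mid_coeff k * ((- 1) ^ k * fact (2 * k))) *
          (- ((2 * real k + 1) / (8 * (real k + 1)) * ((2 * real k + 1) * (2 * real k + 2))))"
    unfolding mid fact
    by (simp only: power_Suc) (simp only: mult_ac mult_minus_left mult_minus_right mult_1)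
  also have "(2 * real k + 1) / (8 * (real k + 1)) * ((2 * real k + 1) * (2 * real k + 2))
      = (real k + 1 / 2)\<^sup>2"
    by (simp add: divide_simps power2_eq_square) (simp add: algebra_simps)
  finally show ?case unfolding Suc poly_mid_basis_Suc by simp
qed (simp add: mid_coeff_def mid_basis_def)

lemma mid_interp_mid_basis:
  assumes "k \<le> N"
  shows "mid_interp N (poly (mid_basis k)) = poly (mid_basis k) 0"
proof -
  have "mid_interp N (poly (mid_basis k))
      = (\<Sum>n\<le>N. if n = k then mid_coeff k * ((- 1) ^ k * fact (2 * k)) else 0)"
    unfolding mid_interp_def
    by (intro sum.cong) (auto simp: neg_diff2_funpow_mid_basis power2_eq_square)
  also have "\<dots> = poly (mid_basis k) 0" using assms by (simp add: mid_coeff_fact)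
  finally show ?thesis .
qed

lemma mid_interp_odd:
  assumes "\<And>y. h (- y) = - h y"
  shows "mid_interp N h = 0"
  unfolding mid_interp_def using neg_diff2_funpow_odd[of h _ "1 / 2"] assms by simp

text \<open>The leading term is removed with a monic \<open>B\<close> of degree \<open>d\<close>:
  for even \<open>d\<close> its index is at most \<open>N\<close>, for odd \<open>d\<close> both
  sides vanish on \<open>B\<close> by oddness.\<close>

lemma mid_interp_poly:
  assumes "degree p < d" "d \<le> 2 * N + 2"
  shows "mid_interp N (poly p) = poly p 0"
  using assms
proof (induction d arbitrary: p)
  case (Suc d)
  define B where "B = (if even d then mid_basis (d div 2) else pCons 0 (mid_basis (d div 2)))"
  have "mid_basis (d div 2) \<noteq> 0" using mid_basis_monic[of "d div 2"] by auto
  then have deg: "degree B = d" and lc: "coeff B d = 1"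
    using mid_basis_monic[of "d div 2"] by (auto simp: B_def elim!: oddE)
  have B: "mid_interp N (poly B) = poly B 0"
  proof (cases "even d")
    case True
    then show ?thesis using Suc.prems(2) by (auto simp: B_def intro!: mid_interp_mid_basis)
  next
    case False
    then show ?thesis by (simp add: B_def) (rule mid_interp_odd, simp add: poly_mid_basis_even)
  qed
  define r where "r = p - smult (coeff p d) B"
  \<comment> \<open>For \<open>d = 0\<close> the induction hypothesis is vacuous, and only
    \<open>r = 0\<close> is possible.\<close>
  have "r = 0 \<or> degree r < d"
    unfolding r_def using Suc.prems(1) deg lc
    by (intro eq_zero_or_degree_less degree_diff_le order.trans[OF degree_smult_le]) auto
  then have r: "mid_interp N (poly r) = poly r 0"
  proof
    assume "r = 0"
    then show ?thesis by (simp add: mid_interp_odd)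
  qed (use Suc in auto)
  have p: "poly p = (\<lambda>x. coeff p d * poly B x + poly r x)" by (auto simp: r_def)
  show ?case unfolding p mid_interp_linear B r ..
qed simp

section \<open>The recursion on polynomial data\<close>

text \<open>The start is \<open>f - neg_diff2 f\<close>, and each level applies
  \<open>neg_diff2\<close> once more; in this form the sums in \<open>aux_p_even\<close>
  telescope.\<close>

lemma aux_C_even:
  "aux_C f n (2 * i) = (neg_diff2 ^^ n) f i - (neg_diff2 ^^ Suc n) f i"
proof (induction n arbitrary: i)
  case (Suc n)
  show ?case using Suc[of i] Suc[of "i + 1"] Suc[of "i - 1"]
    by (simp add: neg_diff2_def algebra_simps)
qed (simp add: neg_diff2_def)

lemma aux_p_even: "aux_p \<alpha> f n (2 * i) = f i - \<alpha> * (neg_diff2 ^^ Suc n) f i"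
proof (induction n)
  case (Suc n)
  have "aux_p \<alpha> f (Suc n) (2 * i) = aux_p \<alpha> f n (2 * i) + \<alpha> * aux_C f (Suc n) (2 * i)"
    by simp
  then show ?case unfolding Suc aux_C_even by (simp add: algebra_simps)
qed (simp add: neg_diff2_def algebra_simps)

lemma mid_coeff_Suc:
  "mid_coeff (Suc n) = 1 / real (Suc n) * (real (Suc n) / 4 - 1 / 8) * mid_coeff n"
  by (simp add: mid_coeff_def divide_simps) (simp add: algebra_simps)

text \<open>Each level applies \<open>neg_diff2\<close> and multiplies by exactly the ratio of
  successive \<open>mid_coeff\<close>.\<close>

lemma aux_C_odd:
  "aux_C f n (2 * i + 1) = mid_coeff n * (((neg_diff2 ^^ n) f i + (neg_diff2 ^^ n) f (i + 1)) / 2)"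
proof (induction n arbitrary: i)
  case (Suc n)
  have i: "2 * i + 1 + 2 = 2 * (i + 1) + 1" "2 * i + 1 - 2 = 2 * (i - 1) + 1" by simp_all
  have "aux_C f (Suc n) (2 * i + 1) = 1 / real (Suc n) * (real (Suc n) / 4 - 1 / 8) *
      ((aux_C f n (2 * i + 1) - aux_C f n (2 * (i + 1) + 1)) +
       (aux_C f n (2 * i + 1) - aux_C f n (2 * (i - 1) + 1)))"
    unfolding aux_C.simps(2) i by simp
  then show ?case unfolding Suc mid_coeff_Suc
    by (simp only: funpow.simps o_apply) (simp add: neg_diff2_def field_simps)
qed (simp add: mid_coeff_def)

lemma aux_p_odd: "aux_p \<alpha> f N (2 * i + 1) = (\<Sum>n\<le>N. aux_C f n (2 * i + 1))"
  by (induction N) (simp_all del: aux_C.simps(2))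

lemma aux_p_poly:
  assumes "degree p \<le> 2 * N + 1"
  shows "aux_p \<alpha> (\<lambda>i. poly p (of_int i)) N k = poly p (of_int k / 2)"
proof (cases "even k")
  case True
  then obtain i where k: "k = 2 * i" by blast
  have "(neg_diff2 ^^ Suc N) (\<lambda>i. poly p (of_int i)) = (\<lambda>i::int. 0)"
    using neg_diff2_funpow_of_int[of "Suc N" "poly p" 0] neg_diff2_funpow_poly[of p "Suc N"] assms
    by (simp del: funpow.simps)
  then show ?thesis unfolding k aux_p_even by simp
next
  case False
  then obtain i where k: "k = 2 * i + 1" by (blast elim: oddE)
  \<comment> \<open>Recentring moves the midpoint to the origin, so that the data at
    \<open>i\<close> and \<open>i + 1\<close> sit at -1/2 and 1/2.\<close>
  define h where "h = pcompose p [:of_int i + 1 / 2, 1:]"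
  have "degree h < 2 * N + 2" using assms by (simp add: h_def degree_pcompose)
  then have interp: "mid_interp N (poly h) = poly h 0" by (rule mid_interp_poly) simp
  have f: "(\<lambda>j. poly p (of_int j)) = (\<lambda>j::int. poly h (of_int j + (- of_int i - 1 / 2)))"
    by (simp add: h_def poly_pcompose)
  have "aux_p \<alpha> (\<lambda>i. poly p (of_int i)) N k = mid_interp N (poly h)"
    unfolding k aux_p_odd aux_C_odd f neg_diff2_funpow_of_int mid_interp_def by simp
  then show ?thesis unfolding interp by (simp add: h_def poly_pcompose k add_divide_distrib)
qed

section \<open>Polynomial generation\<close>

text \<open>Exactness of one step, applied to the dilated polynomial \<open>q\<close>, keeps every
  level on samples of \<open>g\<close>; all errors are then zero.\<close>

lemma generates_polys_uptoI:
  assumes "\<And>p k. degree p \<le> d \<Longrightarrow> S (\<lambda>i. poly p (of_int i)) k = poly p (of_int k / 2)"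
  shows "generates_polys_upto S d"
  unfolding generates_polys_upto_def
proof
  fix g assume "g \<in> polys_upto d"
  then obtain p where g: "g = poly p" and p: "degree p \<le> d" by (auto simp: polys_upto_def)
  have iter: "(S ^^ k) (\<lambda>i. g (of_int i)) = (\<lambda>i. g (of_int i / 2 ^ k))" for k
  proof (induction k)
    case (Suc k)
    define q where "q = pcompose p [:0, 1 / 2 ^ k:]"
    have q: "poly q x = g (x / 2 ^ k)" for x by (simp add: q_def g poly_pcompose)
    have "degree q \<le> d" using p by (simp add: q_def degree_pcompose)
    from assms[OF this] show ?case by (auto simp: Suc q mult.commute)
  qed simp
  have "scheme_limit S (\<lambda>i. g (of_int i)) g"
    unfolding scheme_limit_def iter
    by (simp add: g bot_ennreal[symmetric] SUP_bot continuous_on_poly)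
  then show "\<exists>F\<in>polys_upto d. scheme_limit S (\<lambda>i. g (of_int i)) F"
    using \<open>g \<in> polys_upto d\<close> by blast
qed

text \<open>The defining property of the mask lets the scheme be studied through the recursion,
  without computing coefficients.\<close>

lemma scheme_2N2_eq: "scheme_2N2 N \<alpha> f = aux_p \<alpha> f N"
proof
  fix k :: int
  have "is_mask \<alpha> N (mask_a \<alpha> N)" by (rule is_mask_mask_a)
  then show "scheme_2N2 N \<alpha> f k = aux_p \<alpha> f N k"
    unfolding is_mask_def scheme_2N2_def Let_def by (cases "even k") (auto elim!: evenE oddE)
qed

text \<open>With \<open>m = j + N + 2\<close> and the absorption identity for binomial coefficients, the formula for the
  inner coefficients of the extra term takes a form that also gives the two boundary values.\<close>

definition extra_coeff :: "nat \<Rightarrow> nat \<Rightarrow> real" where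
  "extra_coeff M m = - ((- 1) ^ m * real (M choose m) * ((2 * real m - real M) / real M))"

text \<open>At both ends \<open>mask_a\<close> vanishes and \<open>extra_coeff\<close> is 1, since
  \<open>2 * N + 3\<close> is odd; between them absorption applies.\<close>

lemma mask_b_odd:
  assumes "m \<le> 2 * N + 3" and j: "j = int m - int N - 2"
  shows "mask_b N \<alpha> \<beta> (2 * j + 1)
    = mask_a \<alpha> N (2 * j + 1) + \<beta> * (1 - \<alpha>) * extra_coeff (2 * N + 3) m"
proof -
  have zero: "mask_a \<alpha> N k = 0" if "k < - 2 * (int N + 1) \<or> 2 * (int N + 1) < k" for k
    using that is_mask_mask_a[of \<alpha> N] unfolding is_mask_def by blast
  have unfold: "mask_b N \<alpha> \<beta> (2 * j + 1) =
     (if j \<in> {- int N - 1..int N} then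
       mask_a \<alpha> N (2 * j + 1) +
       (- 1) ^ nat (j + int N + 1) * (of_int (2 * j + 1) / of_int (int N - j + 1)) *
         real ((2 * N + 2) choose nat (int N + j + 2)) * \<beta> * (1 - \<alpha>)
     else if j = - (int N + 2) \<or> j = int N + 1 then \<beta> * (1 - \<alpha>)
     else 0)"
    by (simp add: mask_b_def)
  consider "m = 0" | "m = 2 * N + 3" | m' where "m = Suc m'" "m' \<le> 2 * N + 1"
    using assms(1) by (cases m) (auto simp: le_Suc_eq)
  then show ?thesis
  proof cases
    case 1
    then have "extra_coeff (2 * N + 3) m = 1"
      by (simp add: extra_coeff_def divide_simps)
    then show ?thesis using 1 j unfolding unfold by (simp add: zero)
  next
    case 2
    then have "extra_coeff (2 * N + 3) m = 1"
      by (simp add: extra_coeff_def divide_simps)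
    then show ?thesis using 2 j unfolding unfold by (simp add: zero)
  next
    case 3
    have j': "j = int m' - int N - 1" using 3 j by simp
    \<comment> \<open>The sign exponent is \<open>m - 1\<close>, whence the minus sign in
      \<open>extra_coeff\<close>.\<close>
    have nats: "nat (j + int N + 1) = m'" "nat (int N + j + 2) = m" using j' j by simp_all
    have reals: "of_int (2 * j + 1) = 2 * real m - (2 * real N + 3)"
      "of_int (int N - j + 1) = 2 * real N + 3 - real m"
      by (simp_all add: j)
    have pos: "2 * real N + 3 - real m > 0" using 3 by simp
    have "(2 * N + 3 - m) * ((2 * N + 3) choose m) = (2 * N + 3) * ((2 * N + 2) choose m)"
      using binomial_absorb_comp[of "2 * N + 3" m] by simp
    then have "real (2 * N + 3 - m) * real ((2 * N + 3) choose m)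
        = real (2 * N + 3) * real ((2 * N + 2) choose m)"
      by (metis of_nat_mult)
    moreover have "real (2 * N + 3 - m) = 2 * real N + 3 - real m"
      using assms(1) by (simp add: of_nat_diff)
    ultimately have binom: "real ((2 * N + 3) choose m) * (2 * real N + 3 - real m)
        = (2 * real N + 3) * real ((2 * N + 2) choose m)"
      by (simp add: mult.commute)
    have "mask_b N \<alpha> \<beta> (2 * j + 1) = mask_a \<alpha> N (2 * j + 1) +
        (- 1) ^ m' * ((2 * real m - (2 * real N + 3)) / (2 * real N + 3 - real m)) *
        real ((2 * N + 2) choose m) * \<beta> * (1 - \<alpha>)"
      unfolding unfold nats reals using 3 j' by simp
    also have "(- 1) ^ m' * ((2 * real m - (2 * real N + 3)) / (2 * real N + 3 - real m)) *
        real ((2 * N + 2) choose m) = extra_coeff (2 * N + 3) m"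
    proof -
      have "real ((2 * N + 2) choose m) / (2 * real N + 3 - real m)
          = real ((2 * N + 3) choose m) / (2 * real N + 3)"
        using pos binom by (simp add: frac_eq_eq mult.commute)
      then have "(- 1) ^ m' * (2 * real m - (2 * real N + 3)) *
            (real ((2 * N + 2) choose m) / (2 * real N + 3 - real m))
          = (- 1) ^ m' * (2 * real m - (2 * real N + 3)) *
            (real ((2 * N + 3) choose m) / (2 * real N + 3))"
        by (rule arg_cong)
      moreover have "real (2 * N + 3) = 2 * real N + 3" "(- 1 :: real) ^ m = - ((- 1) ^ m')"
        by (simp_all add: 3(1))
      ultimately show ?thesis unfolding extra_coeff_def
        by (simp add: mult_ac)
    qed
    finally show ?thesis by (simp add: mult_ac)
  qed
qed

text \<open>The factor \<open>2 * m - M\<close> is the linear polynomial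
  \<open>2 * y - 2 * x - M\<close> at \<open>y = x + m\<close>; it raises the degree by at most one,
  still below \<open>M\<close>.\<close>

lemma extra_coeff_poly_sum:
  assumes "degree p + 1 < M"
  shows "(\<Sum>m\<le>M. extra_coeff M m * poly p (x + real m)) = 0"
proof -
  define r where "r = p * [:- 2 * x - real M, 2:]"
  have "degree r < M"
    using degree_mult_le[of p "[:- 2 * x - real M, 2:]"] assms by (simp add: r_def)
  then have "(\<Sum>m\<le>M. (- 1) ^ m * real (M choose m) * poly r (x + real m)) = 0"
    by (intro alternating_binomial_poly_sum) simp
  moreover have "(\<Sum>m\<le>M. extra_coeff M m * poly p (x + real m))
      = (- 1 / real M) * (\<Sum>m\<le>M. (- 1) ^ m * real (M choose m) * poly r (x + real m))"
    unfolding sum_distrib_left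
    using assms by (intro sum.cong) (auto simp: r_def extra_coeff_def field_simps)
  ultimately show ?thesis by simp
qed

lemma scheme_2N3_poly:
  assumes "degree p \<le> 2 * N + 1"
  shows "scheme_2N3 N \<alpha> \<beta> (\<lambda>i. poly p (of_int i)) k = scheme_2N2 N \<alpha> (\<lambda>i. poly p (of_int i)) k"
proof (cases "even k")
  case True
  then show ?thesis unfolding scheme_2N3_def scheme_2N2_def Let_def
    by (auto simp: mask_b_def intro!: sum.cong)
next
  case False
  define i where "i = k div 2"
  let ?f = "\<lambda>j. poly p (of_int (i + j + 1))"
  have reindex: "(\<Sum>j = - int N - 2..int N + 1. u j) = (\<Sum>m\<le>2 * N + 3. u (int m - int N - 2))"
    for u :: "int \<Rightarrow> real"
    by (rule sum.reindex_bij_witness[of _ "\<lambda>m. int m - int N - 2" "\<lambda>j. nat (j + int N + 2)"]) auto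
  have "(\<Sum>m\<le>2 * N + 3. extra_coeff (2 * N + 3) m * ?f (int m - int N - 2)) = 0"
    using extra_coeff_poly_sum[of p "2 * N + 3" "of_int i - real N - 1"] assms
    by (simp add: algebra_simps)
  then have "(\<Sum>m\<le>2 * N + 3. c * extra_coeff (2 * N + 3) m * ?f (int m - int N - 2)) = 0" for c
    by (simp only: mult.assoc sum_distrib_left[symmetric] mult_zero_right)
  moreover have "mask_b N \<alpha> \<beta> (2 * (int m - int N - 2) + 1) * y
      = mask_a \<alpha> N (2 * (int m - int N - 2) + 1) * y + \<beta> * (1 - \<alpha>) * extra_coeff (2 * N + 3) m * y"
    if "m \<in> {..2 * N + 3}" for m y
    using mask_b_odd[OF _ refl, of m N \<alpha> \<beta>] that by (simp only: atMost_iff distrib_right)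
  ultimately have "(\<Sum>j = - int N - 2..int N + 1. mask_b N \<alpha> \<beta> (2 * j + 1) * ?f j)
      = (\<Sum>j = - int N - 2..int N + 1. mask_a \<alpha> N (2 * j + 1) * ?f j)"
    unfolding reindex by (simp only: sum.distrib add_0_right cong: sum.cong)
  \<comment> \<open>The two additional end indices lie outside the support of
    \<open>mask_a\<close>.\<close>
  also have "\<dots> = (\<Sum>j = - int N - 1..int N. mask_a \<alpha> N (2 * j + 1) * ?f j)"
  proof (rule sum.mono_neutral_right)
    show "\<forall>j\<in>{- int N - 2..int N + 1} - {- int N - 1..int N}. mask_a \<alpha> N (2 * j + 1) * ?f j = 0"
      using is_mask_mask_a[of \<alpha> N] unfolding is_mask_def by auto
  qed auto
  finally show ?thesis using False unfolding scheme_2N3_def scheme_2N2_def Let_def i_def by simp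
qed

theorem theorem4p2:
  fixes N :: nat
  shows "(\<forall>\<alpha>::real. generates_polys_upto (scheme_2N2 N \<alpha>) (2 * N + 1)) \<and>
         (\<forall>\<alpha> \<beta>::real. - 1 < \<alpha> \<and> \<alpha> < 1 \<and> - 1 < \<beta> \<and> \<beta> < 1 \<longrightarrow>
            generates_polys_upto (scheme_2N3 N \<alpha> \<beta>) (2 * N + 1)) \<and>
         (\<forall>\<beta>::real. - 1 < \<beta> \<and> \<beta> < 1 \<longrightarrow>
            generates_polys_upto (scheme_I_2N4 N \<beta>) (2 * N + 1))"
proof -
  have even: "generates_polys_upto (scheme_2N2 N \<alpha>) (2 * N + 1)" for \<alpha>
    by (rule generates_polys_uptoI) (simp only: scheme_2N2_eq aux_p_poly)
  have odd: "generates_polys_upto (scheme_2N3 N \<alpha> \<beta>) (2 * N + 1)" for \<alpha> \<beta>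
    by (rule generates_polys_uptoI) (simp only: scheme_2N3_poly scheme_2N2_eq aux_p_poly)
  show ?thesis using even odd unfolding scheme_I_2N4_def by blast
qed

end
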